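(* Let $\mu:\mathcal{C}\to\mathbb{R}_0^+$ be a finitely additive measure, let $\nu:\mathcal{E}\to\mathbb{R}_0^+$ be a set function with $\nu(\emptyset)=0$, let $A,B\in\mathcal{C}$ with $A\cap B=\emptyset$, and let $f:S\to\mathbb{R}_0^+$ be $\mu$-measurable. If $f\in G_{RL}(\nu,\mu,A)\cap G_{RL}(\nu,\mu,B)\cap G_{RL}(\nu,\mu,A\cup B)$, then $$\int_{A\cup B}^{*} f\,d(\nu,\mu)=\int_A^{*} f\,d(\nu,\mu)+\int_B^{*} f\,d(\nu,\mu).$$
   Context: $\mathbb{R}_0^+=[0,\infty)$. $S$ is a nonempty, at least countable set, $\mathcal{C}$ is a $\sigma$-algebra of subsets of $S$, and $\mathcal{E}$ is a $\sigma$-algebra of subsets of $\mathbb{R}_0^+$ with $\{0\}\in\mathcal{E}$. Set functions on $\mathcal{C}$ and $\mathcal{E}$ have values in $\mathbb{R}_0^+$, vanish on $\emptyset$, and are not assumed additive or monotone unless stated. $\mu$ is finitely additive if $\mu(B\cup C)=\mu(B)+\mu(C)$ for all disjoint $B,C\in\mathcal{C}$. Measurability: $f:S\to\mathbb{R}_0^+$ is $\mu$-measurable if it is $\mathcal{C}$-measurable, i.e. $E_f^\alpha:=\{s\in S: f(s)\ge\alpha\}\in\mathcal{C}$ for all $\alpha\ge 0$. Riemann-Lebesgue (RL) integral: for two countable partitions $P,P'$ of $\mathbb{R}_0^+$, $P'$ is finer than $P$ if every set of $P'$ is included in some set of $P$. A function $g:\mathbb{R}_0^+\to\mathbb{R}$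 is $\nu$-RL integrable if there is $a\in\mathbb{R}$ such that for every $\varepsilon>0$ there is a countable partition $\Pi_\varepsilon$ of $\mathbb{R}_0^+$ into sets of $\mathcal{E}$ such that for every countable partition $\Pi=(E_n)_n$ of $\mathbb{R}_0^+$ into sets of $\mathcal{E}$ finer than $\Pi_\varepsilon$: $g$ is bounded on every $E_n$ with $\nu(E_n)>0$, and for every choice of $s_n\in E_n$ the series $\sum_n g(s_n)\nu(E_n)$ converges absolutely and $|\sum_n g(s_n)\nu(E_n)-a|<\varepsilon$. Then $a$ is unique and is denoted $(RL)\int_{[0,\infty)}g\,d\nu$. Generalized decomposition integral: for a $\mu$-measurable $f:S\to\mathbb{R}_0^+$ and $A\in\mathcal{C}$ put $u_{f,\mu}^{A}(\alpha)=\mu(E_f^\alpha\cap A)$, $\alpha\ge 0$. $f$ is $(\nu,\mu)$-integrable on $A$ if $u_{f,\mu}^A$ is $\nu$-RL integrable on $\mathbb{R}_0^+$, and then $\int_A^{*}f\,d(\nu,\mu):=(RL)\int_{[0,\infty)}u_{f,\mu}^A\,d\nu$. $G_{RL}(\nu,\mu,A)$ is the set of all $\mu$-measurable $f:S\to\mathbb{R}_0^+$ that are $(\nu,\mu)$-integrable on $A$ (with finite integral). *)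

theory Defs
  imports "HOL-Analysis.Analysis"
begin

text \<open>The half line of nonnegative reals is the set \<^term>\<open>{0::real..}\<close>, and set functions with
  finite values are total real-valued functions that are constrained on their algebra only.\<close>

definition set_function :: "'a set set \<Rightarrow> ('a set \<Rightarrow> real) \<Rightarrow> bool" where
  "set_function M m \<longleftrightarrow> m {} = 0 \<and> (\<forall>X\<in>M. 0 \<le> m X)"

definition superlevel :: "'a set \<Rightarrow> ('a \<Rightarrow> real) \<Rightarrow> real \<Rightarrow> 'a set" where
  "superlevel S f \<alpha> = {s \<in> S. \<alpha> \<le> f s}"

definition level_measurable :: "'a set \<Rightarrow> 'a set set \<Rightarrow> ('a \<Rightarrow> real) \<Rightarrow> bool" where
  "level_measurable S \<C> f \<longleftrightarrow> f \<in> S \<rightarrow> {0..} \<and> (\<forall>\<alpha>\<ge>0. superlevel S f \<alpha> \<in> \<C>)"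

text \<open>``Countable'' includes ``finite'', and the sets of a partition are nonempty.\<close>

definition countable_partition :: "real set set \<Rightarrow> real set set \<Rightarrow> bool" where
  "countable_partition \<E> P \<longleftrightarrow> countable P \<and> P \<subseteq> \<E> \<and> partition_on {0..} P"

text \<open>Partitions are families of sets rather than sequences: the sums involved are required to
  converge absolutely, so their values do not depend on an enumeration. Accordingly a choice of
  points \<^term>\<open>s\<close> is indexed by the sets of the partition. In \<^term>\<open>refines {0..} P Q\<close> the
  partition \<^term>\<open>P\<close> is the finer one.\<close>

definition has_RL_integral ::
    "real set set \<Rightarrow> (real set \<Rightarrow> real) \<Rightarrow> (real \<Rightarrow> real) \<Rightarrow> real \<Rightarrow> bool" where
  "has_RL_integral \<E> \<nu> g a \<longleftrightarrow>
     (\<forall>\<epsilon>>0. \<exists>P0. countable_partition \<E> P0 \<and>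
        (\<forall>P. countable_partition \<E> P \<and> refines {0..} P P0 \<longrightarrow>
           (\<forall>X\<in>P. \<nu> X > 0 \<longrightarrow> bounded (g ` X)) \<and>
           (\<forall>s. (\<forall>X\<in>P. s X \<in> X) \<longrightarrow>
              Infinite_Sum.abs_summable_on (\<lambda>X. g (s X) * \<nu> X) P \<and>
              \<bar>(\<Sum>\<^sub>\<infinity>X\<in>P. g (s X) * \<nu> X) - a\<bar> < \<epsilon>)))"

definition RL_integrable :: "real set set \<Rightarrow> (real set \<Rightarrow> real) \<Rightarrow> (real \<Rightarrow> real) \<Rightarrow> bool" where
  "RL_integrable \<E> \<nu> g \<longleftrightarrow> (\<exists>a. has_RL_integral \<E> \<nu> g a)"

definition RL_integral :: "real set set \<Rightarrow> (real set \<Rightarrow> real) \<Rightarrow> (real \<Rightarrow> real) \<Rightarrow> real" where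
  "RL_integral \<E> \<nu> g = (THE a. has_RL_integral \<E> \<nu> g a)"

definition level_fun :: "'a set \<Rightarrow> ('a set \<Rightarrow> real) \<Rightarrow> ('a \<Rightarrow> real) \<Rightarrow> 'a set \<Rightarrow> real \<Rightarrow> real" where
  "level_fun S \<mu> f A \<alpha> = \<mu> (superlevel S f \<alpha> \<inter> A)"

definition decomp_integrable ::
    "'a set \<Rightarrow> real set set \<Rightarrow> (real set \<Rightarrow> real) \<Rightarrow> ('a set \<Rightarrow> real) \<Rightarrow> 'a set \<Rightarrow> ('a \<Rightarrow> real) \<Rightarrow> bool" where
  "decomp_integrable S \<E> \<nu> \<mu> A f \<longleftrightarrow> RL_integrable \<E> \<nu> (level_fun S \<mu> f A)"

definition decomp_integral ::
    "'a set \<Rightarrow> real set set \<Rightarrow> (real set \<Rightarrow> real) \<Rightarrow> ('a set \<Rightarrow> real) \<Rightarrow> 'a set \<Rightarrow> ('a \<Rightarrow> real) \<Rightarrow> real" where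
  "decomp_integral S \<E> \<nu> \<mu> A f = RL_integral \<E> \<nu> (level_fun S \<mu> f A)"

definition G_RL ::
    "'a set \<Rightarrow> 'a set set \<Rightarrow> real set set \<Rightarrow> (real set \<Rightarrow> real) \<Rightarrow> ('a set \<Rightarrow> real) \<Rightarrow> 'a set
      \<Rightarrow> ('a \<Rightarrow> real) set" where
  "G_RL S \<C> \<E> \<nu> \<mu> A = {f. level_measurable S \<C> f \<and> decomp_integrable S \<E> \<nu> \<mu> A f}"

end

theory Submission
  imports Defs
begin

text \<open>Finite additivity of \<open>\<mu>\<close> makes the level function of \<open>A \<union> B\<close> the sum of those of \<open>A\<close> and \<open>B\<close>.
  On a common refinement of three good partitions the Riemann-Lebesgue sums for one choice of points
  add up, so the integral of a sum is the sum of the integrals. Uniqueness of the integral is the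
  special case in which one summand is zero.\<close>

text \<open>Each cell is the intersection of one set chosen from every partition in
  \<open>\<P>\<close>. Since \<open>\<P>\<close> is finite, the choices form a finite product of
  countable sets, and the intersections stay in \<open>\<E>\<close>.\<close>

lemma countable_partition_common_refinement:
  assumes \<E>: "sigma_algebra {0..} \<E>"
    and \<P>: "\<And>P. P \<in> \<P> \<Longrightarrow> countable_partition \<E> P" and fin: "finite \<P>" "\<P> \<noteq> {}"
  shows "countable_partition \<E> (common_refinement \<P>)"
  unfolding countable_partition_def
proof (intro conjI)
  interpret sigma_algebra "{0..}" \<E> by (fact \<E>)
  have "countable (\<Pi>\<^sub>E P\<in>\<P>. P)"
    using \<P> fin by (intro countable_PiE) (auto simp: countable_partition_def)
  then show "countable (common_refinement \<P>)"
    unfolding common_refinement_def by (intro countable_Diff countable_UN) auto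
  show "common_refinement \<P> \<subseteq> \<E>"
  proof
    fix X assume "X \<in> common_refinement \<P>"
    then obtain f where f: "\<And>P. P \<in> \<P> \<Longrightarrow> f P \<in> P" and X: "X = (\<Inter>P\<in>\<P>. f P)"
      unfolding common_refinement_def by auto
    show "X \<in> \<E>"
      unfolding X
    proof (rule finite_INT)
      show "f P \<in> \<E>" if "P \<in> \<P>" for P
        using f[OF that] \<P>[OF that] by (auto simp: countable_partition_def)
    qed (fact fin)+
  qed
  show "partition_on {0..} (common_refinement \<P>)"
    using \<P> fin by (intro partition_on_common_refinement) (auto simp: countable_partition_def)
qed

lemma has_RL_integralE:
  assumes "has_RL_integral \<E> \<nu> g a" "\<epsilon> > 0"
  obtains P0 where "countable_partition \<E> P0"
    and "\<forall>P s. countable_partition \<E> P \<and> refines {0..} P P0 \<and> (\<forall>X\<in>P. s X \<in> X) \<longrightarrow>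
      Infinite_Sum.abs_summable_on (\<lambda>X. g (s X) * \<nu> X) P \<and>
      \<bar>(\<Sum>\<^sub>\<infinity>X\<in>P. g (s X) * \<nu> X) - a\<bar> < \<epsilon>"
proof -
  from assms(1)[unfolded has_RL_integral_def, rule_format, OF assms(2)]
  show thesis
    by (elim exE conjE, intro that) (assumption, blast)
qed

text \<open>Stated for arbitrary values of the relation rather than for \<open>RL_integral\<close>,
  because the definite description is only justified later, by this very lemma.\<close>

lemma has_RL_integral_add_unique:
  assumes \<E>: "sigma_algebra {0..} \<E>"
    and g: "has_RL_integral \<E> \<nu> g a" and h: "has_RL_integral \<E> \<nu> h b"
    and k: "has_RL_integral \<E> \<nu> k c"
    and add: "\<And>x. x \<ge> 0 \<Longrightarrow> k x = g x + h x"
  shows "c = a + b"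
proof (rule ccontr)
  assume "c \<noteq> a + b"
  \<comment> \<open>Three sums, each off by less than \<open>\<epsilon>\<close>, will give a total
    error below \<open>3 * \<epsilon>\<close>, which is exactly the assumed gap.\<close>
  define \<epsilon> where "\<epsilon> = \<bar>c - (a + b)\<bar> / 3"
  have \<epsilon>: "\<epsilon> > 0"
    using \<open>c \<noteq> a + b\<close> by (simp add: \<epsilon>_def)
  obtain P1 where P1: "countable_partition \<E> P1"
    and sum_g: "\<forall>P s. countable_partition \<E> P \<and> refines {0..} P P1 \<and> (\<forall>X\<in>P. s X \<in> X) \<longrightarrow>
      Infinite_Sum.abs_summable_on (\<lambda>X. g (s X) * \<nu> X) P \<and>
      \<bar>(\<Sum>\<^sub>\<infinity>X\<in>P. g (s X) * \<nu> X) - a\<bar> < \<epsilon>"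
    using has_RL_integralE[OF g \<epsilon>] .
  obtain P2 where P2: "countable_partition \<E> P2"
    and sum_h: "\<forall>P s. countable_partition \<E> P \<and> refines {0..} P P2 \<and> (\<forall>X\<in>P. s X \<in> X) \<longrightarrow>
      Infinite_Sum.abs_summable_on (\<lambda>X. h (s X) * \<nu> X) P \<and>
      \<bar>(\<Sum>\<^sub>\<infinity>X\<in>P. h (s X) * \<nu> X) - b\<bar> < \<epsilon>"
    using has_RL_integralE[OF h \<epsilon>] .
  obtain P3 where P3: "countable_partition \<E> P3"
    and sum_k: "\<forall>P s. countable_partition \<E> P \<and> refines {0..} P P3 \<and> (\<forall>X\<in>P. s X \<in> X) \<longrightarrow>
      Infinite_Sum.abs_summable_on (\<lambda>X. k (s X) * \<nu> X) P \<and>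
      \<bar>(\<Sum>\<^sub>\<infinity>X\<in>P. k (s X) * \<nu> X) - c\<bar> < \<epsilon>"
    using has_RL_integralE[OF k \<epsilon>] .
  define P where "P = common_refinement {P1, P2, P3}"
  have P: "countable_partition \<E> P"
    unfolding P_def using P1 P2 P3 by (intro countable_partition_common_refinement[OF \<E>]) auto
  then have part: "partition_on {0..} P"
    by (simp add: countable_partition_def)
  have refines: "refines {0..} P P1" "refines {0..} P P2" "refines {0..} P P3"
    unfolding P_def using P1 P2 P3
    by (auto intro!: refines_common_refinement simp: countable_partition_def)
  \<comment> \<open>The estimates hold for every choice of points, so one choice suffices; it exists
    because the cells of a partition are nonempty.\<close>
  define s where "s X = (SOME x. x \<in> X)" for X :: "real set"
  have s: "\<forall>X\<in>P. s X \<in> X"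
    using part by (auto simp: s_def partition_on_def some_in_eq)
  \<comment> \<open>The identity \<open>add\<close> is available only on the half line, so the
    chosen points must lie there.\<close>
  have nonneg: "s X \<ge> 0" if "X \<in> P" for X
    using that s partition_onD1[OF part] by (metis UnionI atLeast_iff)
  have g': "Infinite_Sum.abs_summable_on (\<lambda>X. g (s X) * \<nu> X) P \<and>
      \<bar>(\<Sum>\<^sub>\<infinity>X\<in>P. g (s X) * \<nu> X) - a\<bar> < \<epsilon>"
    using sum_g P refines(1) s by blast
  have h': "Infinite_Sum.abs_summable_on (\<lambda>X. h (s X) * \<nu> X) P \<and>
      \<bar>(\<Sum>\<^sub>\<infinity>X\<in>P. h (s X) * \<nu> X) - b\<bar> < \<epsilon>"
    using sum_h P refines(2) s by blast
  have k': "Infinite_Sum.abs_summable_on (\<lambda>X. k (s X) * \<nu> X) P \<and>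
      \<bar>(\<Sum>\<^sub>\<infinity>X\<in>P. k (s X) * \<nu> X) - c\<bar> < \<epsilon>"
    using sum_k P refines(3) s by blast
  have "(\<Sum>\<^sub>\<infinity>X\<in>P. k (s X) * \<nu> X) = (\<Sum>\<^sub>\<infinity>X\<in>P. g (s X) * \<nu> X + h (s X) * \<nu> X)"
    by (intro infsum_cong) (simp add: add nonneg distrib_right)
  \<comment> \<open>An infinite sum may be split only when both parts are summable, which absolute
    convergence provides.\<close>
  also have "\<dots> = (\<Sum>\<^sub>\<infinity>X\<in>P. g (s X) * \<nu> X) + (\<Sum>\<^sub>\<infinity>X\<in>P. h (s X) * \<nu> X)"
    by (rule infsum_add[OF abs_summable_summable abs_summable_summable])
      (simp_all only: g' h')
  finally have "\<bar>c - (a + b)\<bar> < 3 * \<epsilon>"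
    using g' h' k' by linarith
  then show False
    by (simp add: \<epsilon>_def)
qed

text \<open>Supplies the zero summand for the uniqueness argument. Every sum vanishes, so the
  one-cell partition serves for all \<open>\<epsilon>\<close>.\<close>

lemma has_RL_integral_zero:
  assumes "sigma_algebra {0..} \<E>"
  shows "has_RL_integral \<E> \<nu> (\<lambda>_. 0) 0"
proof -
  interpret sigma_algebra "{0..}" \<E> by (fact assms)
  have "countable_partition \<E> {{0..}}"
    using top by (auto simp: countable_partition_def partition_on_def)
  moreover have "bounded ((\<lambda>_. 0 :: real) ` X)" for X :: "real set"
    by (rule finite_imp_bounded) (simp add: image_constant_conv)
  ultimately show ?thesis
    unfolding has_RL_integral_def by auto
qed

text \<open>If \<open>a\<close> and \<open>b\<close> are both values for \<open>g\<close>, then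
  writing \<open>g\<close> as \<open>g\<close> plus zero gives \<open>b = a + 0\<close>.\<close>

lemma RL_integral_eqI:
  assumes "sigma_algebra {0..} \<E>" and "has_RL_integral \<E> \<nu> g a"
  shows "RL_integral \<E> \<nu> g = a"
  unfolding RL_integral_def
proof (rule the_equality)
  show "b = a" if "has_RL_integral \<E> \<nu> g b" for b
    using has_RL_integral_add_unique[OF assms has_RL_integral_zero[OF assms(1)] that] by simp
qed (fact assms(2))

text \<open>The superlevel set lies in \<open>\<C>\<close> for \<alpha> \<ge> 0, so it cuts
  \<open>A\<close> and \<open>B\<close> in two disjoint members of \<open>\<C>\<close>, to which
  finite additivity applies.\<close>

lemma level_fun_Un:
  assumes "sigma_algebra S \<C>" and "Measure_Space.additive \<C> \<mu>"
    and "A \<in> \<C>" "B \<in> \<C>" "A \<inter> B = {}"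
    and "level_measurable S \<C> f" and "\<alpha> \<ge> 0"
  shows "level_fun S \<mu> f (A \<union> B) \<alpha> = level_fun S \<mu> f A \<alpha> + level_fun S \<mu> f B \<alpha>"
proof -
  interpret sigma_algebra S \<C> by (fact assms)
  have E: "superlevel S f \<alpha> \<in> \<C>"
    using assms by (simp add: level_measurable_def)
  have "\<mu> (superlevel S f \<alpha> \<inter> A \<union> superlevel S f \<alpha> \<inter> B) =
      \<mu> (superlevel S f \<alpha> \<inter> A) + \<mu> (superlevel S f \<alpha> \<inter> B)"
    using E assms(3-5) by (intro additiveD[OF assms(2)]) auto
  then show ?thesis
    by (simp add: level_fun_def Int_Un_distrib)
qed

theorem theorem3p19:
  fixes S :: "'a set" and \<C> :: "'a set set" and \<E> :: "real set set"
    and \<mu> :: "'a set \<Rightarrow> real" and \<nu> :: "real set \<Rightarrow> real"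
    and A B :: "'a set" and f :: "'a \<Rightarrow> real"
  assumes "S \<noteq> {}" and "infinite S"
    and "sigma_algebra S \<C>"
    and "sigma_algebra {0..} \<E>" and "{0} \<in> \<E>"
    and "set_function \<C> \<mu>" and "Measure_Space.additive \<C> \<mu>"
    and "set_function \<E> \<nu>"
    and "A \<in> \<C>" and "B \<in> \<C>" and "A \<inter> B = {}"
    and "level_measurable S \<C> f"
    and "f \<in> G_RL S \<C> \<E> \<nu> \<mu> A \<inter> G_RL S \<C> \<E> \<nu> \<mu> B \<inter> G_RL S \<C> \<E> \<nu> \<mu> (A \<union> B)"
  shows "decomp_integral S \<E> \<nu> \<mu> (A \<union> B) f
       = decomp_integral S \<E> \<nu> \<mu> A f + decomp_integral S \<E> \<nu> \<mu> B f"
proof -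
  \<comment> \<open>Membership in \<open>G_RL\<close> yields only the existence of values;
    \<open>RL_integral_eqI\<close> identifies them with the integrals at the end.\<close>
  obtain a b c where a: "has_RL_integral \<E> \<nu> (level_fun S \<mu> f A) a"
    and b: "has_RL_integral \<E> \<nu> (level_fun S \<mu> f B) b"
    and c: "has_RL_integral \<E> \<nu> (level_fun S \<mu> f (A \<union> B)) c"
    using assms(13) by (auto simp: G_RL_def decomp_integrable_def RL_integrable_def)
  have "c = a + b"
    by (rule has_RL_integral_add_unique[OF assms(4) a b c level_fun_Un[OF assms(3,7,9-12)]])
  then show ?thesis
    by (simp add: decomp_integral_def RL_integral_eqI[OF assms(4) a]
        RL_integral_eqI[OF assms(4) b] RL_integral_eqI[OF assms(4) c])
qed

end
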